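(* Let $C>0$, $\theta \in (0,1)$ and $\kappa>0$ be real numbers. There is a constant $K>0$, depending at most on $C$, $\theta$ and $\kappa$, such that the following holds. Let $x \ge 2$ and $Q \ge 2$ be real numbers with $Q \geq \kappa \log x$. Let $f$ be an integer-valued arithmetic function such that for every positive integer $n \le x$: (i) $1 \leq f(n) \leq C x^\theta$; (ii) $f(n) \mid (n-1)$. Then for any sequence $(a_n)_n$ of complex numbers, $$ \sum_{q \leq Q}\ \sum_{c, d \in \mathbb{F}_q^{*}} \left| \sum_{\substack{n \leq x \\ (q, f(n))=1}} a_n\, e\left( \frac{nd+f(n)c}{q} \right) \right|^2 \ \leq\ K\,\left(Qx + Q^3 x^\theta \log Q\right) \sum_{n \leq x} |a_n|^2. $$
   Context: Notation: $e(t) = e^{2\pi i t}$. The sum $\sum_{q\le Q}$ runs over odd primes $q \le Q$; $\mathbb{F}_q^{*}$ is identified with the residues $\{1,\dots,q-1\}$ modulo $q$. The sum over $n \le x$ is over positive integers, and $(q,f(n))$ denotes the greatest common divisor. *)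

theory Defs
  imports Complex_Main "HOL-Computational_Algebra.Primes"
begin

definition unit_exp :: "real \<Rightarrow> complex" where
  "unit_exp t = exp (2 * of_real pi * \<i> * of_real t)"

end

theory Submission
  imports Defs "HOL-Analysis.Analysis"
begin

text \<open>
  Group the \<open>n\<close> by \<open>k = f n\<close> and let \<open>S\<^sub>k(d/q)\<close> be the sum of \<open>a\<^sub>n e(nd/q)\<close> over the \<open>k\<close>-th group.
  The sum over \<open>c\<close> detects \<open>k \<equiv> l (mod q)\<close>, and Cauchy-Schwarz with weights \<open>k\<close> bounds it by
  \<open>\<Sum>\<^sub>k k |S\<^sub>k(d/q)|\<^sup>2\<close> times \<open>q \<Sum> 1/l \<le> q + H\<^sub>N\<close>, the sum running over one class modulo \<open>q\<close> up to
  \<open>N = \<lfloor>C x\<^sup>\<theta>\<rfloor>\<close>. This factor is \<open>O(Q)\<close> because \<open>ln x \<le> Q / \<kappa>\<close>. As \<open>k\<close> divides \<open>n - 1\<close>, the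
  sum \<open>S\<^sub>k\<close> runs over at most \<open>x/k + 1\<close> terms of a progression, so for \<open>q\<close> coprime to \<open>k\<close> the large
  sieve at the points \<open>kd/q\<close> saves the factor \<open>k\<close>: it contributes \<open>k (x/k + Q\<^sup>2) \<le> x + C x\<^sup>\<theta> Q\<^sup>2\<close>.

  The large sieve itself is proved in its dual form, by averaging over the differences \<open>i - j\<close> with
  \<open>i, j < L\<close>, which turns the kernel into the square of a geometric sum.
\<close>

section \<open>Additive characters and the size of 1 - e(t)\<close>

lemma unit_exp_cis: "unit_exp t = cis (2 * pi * t)"
  by (simp add: unit_exp_def cis_conv_exp mult_ac)

lemma norm_unit_exp [simp]: "cmod (unit_exp t) = 1"
  by (simp add: unit_exp_cis)

lemma unit_exp_add: "unit_exp (s + t) = unit_exp s * unit_exp t"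
  by (simp add: unit_exp_cis cis_mult algebra_simps)

lemma cnj_unit_exp: "cnj (unit_exp t) = unit_exp (- t)"
  by (simp add: unit_exp_cis cis_cnj)

lemma unit_exp_of_nat_mult: "unit_exp (real n * t) = unit_exp t ^ n"
  by (simp add: unit_exp_cis Complex.DeMoivre mult_ac)

lemma unit_exp_of_int [simp]: "unit_exp (of_int n) = 1"
proof -
  have "2 * pi * real_of_int n = real_of_int n * (2 * pi)" by simp
  then show ?thesis unfolding unit_exp_cis by (metis cis_multiple_2pi Ints_of_int mult.commute)
qed

lemma unit_exp_frac: "unit_exp (frac t) = unit_exp t"
proof -
  have "unit_exp t = unit_exp (frac t + of_int \<lfloor>t\<rfloor>)" by (simp add: frac_def)
  then show ?thesis by (simp add: unit_exp_add del: of_int_floor_le)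
qed

text \<open>With y = x/2, the mean value theorem gives sin y >= y cos y, so sin 2y >= 2y cos^2 y,
  and cos^2 y >= 1/2 because cos 2y >= 0. This is weaker than Jordan's 2/pi, but only a constant is
  at stake.\<close>

lemma half_le_sin:
  fixes x :: real
  assumes "0 \<le> x" "x \<le> pi / 2"
  shows "x / 2 \<le> sin x"
proof (cases "x = 0")
  case False
  define y where "y = x / 2"
  have y: "0 < y" "y \<le> pi / 4" using assms False by (auto simp: y_def)
  obtain z where z: "0 < z" "z < y" "sin y - sin 0 = (y - 0) * cos z"
    using MVT2[of 0 y sin cos] y(1) by (auto intro: DERIV_sin)
  have c: "cos y \<le> cos z" using z y by (intro cos_monotone_0_pi_le) auto
  have c0: "cos y \<ge> 0" using y by (intro cos_ge_zero) auto
  have "0 \<le> cos (2 * y)" using y by (intro cos_ge_zero) auto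
  then have "1 / 2 \<le> cos y * cos y" by (simp add: cos_double_cos power2_eq_square)
  then have "y * 1 \<le> y * (2 * (cos y * cos y))" using y(1) by (intro mult_left_mono) auto
  also have "\<dots> \<le> 2 * (y * cos z) * cos y" using mult_right_mono[OF c c0] y(1) by (simp add: mult_ac)
  also have "\<dots> = sin (2 * y)" using z(3) by (simp add: sin_double)
  finally show ?thesis by (simp add: y_def)
qed simp

text \<open>Both squares equal 2 - 2 cos(2 pi t), by the double angle formula.\<close>

lemma norm_one_minus_unit_exp: "cmod (1 - unit_exp t) = 2 * \<bar>sin (pi * t)\<bar>"
proof -
  have "(cmod (1 - unit_exp t))\<^sup>2 = (2 * \<bar>sin (pi * t)\<bar>)\<^sup>2"
    using cos_double_sin[of "pi*t"] sin_cos_squared_add[of "2 * (pi*t)"]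
    unfolding unit_exp_cis cmod_power2 by (simp add: power2_eq_square algebra_simps)
  then show ?thesis
    by (smt (verit, best) norm_ge_zero abs_ge_zero power2_eq_imp_eq)
qed

lemma unit_exp_eq_1D:
  assumes "unit_exp t = 1"
  shows "t \<in> \<int>"
proof -
  have "sin (pi * t) = 0" using norm_one_minus_unit_exp[of t] assms by simp
  then obtain i where "pi * t = of_int i * pi" using sin_zero_iff_int2 by blast
  then have "t = of_int i" by simp
  then show ?thesis by simp
qed

section \<open>Bounds for quadratic forms: a weighted Schur test and duality\<close>

text \<open>Expanding the square produces the Gram matrix \<open>G\<close>. Weighted AM-GM splits
  each |z_i z_j| into two terms, and the two resulting sums agree since |G| is symmetric. The
  weights are 1 in the large sieve and the values k in the sum over c.\<close>

lemma gram_schur_bound: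
  fixes u :: "'t \<Rightarrow> 'i \<Rightarrow> complex" and z :: "'i \<Rightarrow> complex" and \<rho> :: "'i \<Rightarrow> real"
  assumes \<rho>: "\<And>i. i \<in> A \<Longrightarrow> \<rho> i > 0"
  shows "(\<Sum>t\<in>T. (cmod (\<Sum>i\<in>A. z i * u t i))\<^sup>2)
    \<le> (\<Sum>i\<in>A. \<rho> i * (cmod (z i))\<^sup>2 * (\<Sum>j\<in>A. cmod (\<Sum>t\<in>T. u t i * cnj (u t j)) / \<rho> j))"
proof -
  define G where "G i j = (\<Sum>t\<in>T. u t i * cnj (u t j))" for i j
  have Gsym: "cmod (G j i) = cmod (G i j)" for i j
  proof -
    have "G j i = cnj (G i j)" by (simp add: G_def mult.commute)
    then show ?thesis by simp
  qed
  have "complex_of_real (\<Sum>t\<in>T. (cmod (\<Sum>i\<in>A. z i * u t i))\<^sup>2)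
      = (\<Sum>t\<in>T. \<Sum>i\<in>A. \<Sum>j\<in>A. (z i * u t i) * cnj (z j * u t j))"
    by (simp add: complex_norm_square sum_product del: of_real_power)
  also have "\<dots> = (\<Sum>i\<in>A. \<Sum>t\<in>T. \<Sum>j\<in>A. (z i * u t i) * cnj (z j * u t j))"
    by (rule sum.swap)
  also have "\<dots> = (\<Sum>i\<in>A. \<Sum>j\<in>A. \<Sum>t\<in>T. (z i * u t i) * cnj (z j * u t j))"
    by (intro sum.cong refl sum.swap)
  also have "\<dots> = (\<Sum>i\<in>A. \<Sum>j\<in>A. z i * cnj (z j) * G i j)"
    by (simp add: G_def sum_distrib_left mult_ac)
  finally have "(\<Sum>t\<in>T. (cmod (\<Sum>i\<in>A. z i * u t i))\<^sup>2) = cmod (\<Sum>i\<in>A. \<Sum>j\<in>A. z i * cnj (z j) * G i j)"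
    by (metis (no_types, lifting) abs_of_nonneg norm_of_real sum_nonneg zero_le_power2)
  also have "\<dots> \<le> (\<Sum>i\<in>A. \<Sum>j\<in>A. cmod (z i) * cmod (z j) * cmod (G i j))"
    by (intro order_trans[OF norm_sum] sum_mono) (simp add: norm_mult)
  also have "\<dots> \<le> (\<Sum>i\<in>A. \<Sum>j\<in>A. (\<rho> i * (cmod (z i))\<^sup>2 * (cmod (G i j) / \<rho> j)
       + \<rho> j * (cmod (z j))\<^sup>2 * (cmod (G i j) / \<rho> i)) / 2)"
  proof (intro sum_mono)
    fix i j assume "i \<in> A" "j \<in> A"
    then have p: "\<rho> i > 0" "\<rho> j > 0" using \<rho> by auto
    have "0 \<le> (\<rho> i * cmod (z i) - \<rho> j * cmod (z j))\<^sup>2 * (cmod (G i j) / (\<rho> i * \<rho> j))"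
      using p by simp
    then show "cmod (z i) * cmod (z j) * cmod (G i j)
      \<le> (\<rho> i * (cmod (z i))\<^sup>2 * (cmod (G i j) / \<rho> j) + \<rho> j * (cmod (z j))\<^sup>2 * (cmod (G i j) / \<rho> i)) / 2"
      using p by (simp add: field_simps power2_eq_square)
  qed
  also have "\<dots> = ((\<Sum>i\<in>A. \<Sum>j\<in>A. \<rho> i * (cmod (z i))\<^sup>2 * (cmod (G i j) / \<rho> j))
       + (\<Sum>i\<in>A. \<Sum>j\<in>A. \<rho> j * (cmod (z j))\<^sup>2 * (cmod (G i j) / \<rho> i))) / 2"
    by (simp add: sum.distrib flip: sum_divide_distrib)
  also have "(\<Sum>i\<in>A. \<Sum>j\<in>A. \<rho> j * (cmod (z j))\<^sup>2 * (cmod (G i j) / \<rho> i))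
      = (\<Sum>i\<in>A. \<Sum>j\<in>A. \<rho> i * (cmod (z i))\<^sup>2 * (cmod (G i j) / \<rho> j))"
    by (subst sum.swap) (simp add: Gsym)
  finally show ?thesis by (simp only: G_def sum_distrib_left field_sum_of_halves add_divide_distrib)
qed

text \<open>An operator and its transpose have the same norm: the dual bound is tested on the
  conjugates of the sums \<open>S r\<close>, and Cauchy-Schwarz yields X^2 <= B D X.\<close>

lemma duality_bound:
  fixes u :: "'r \<Rightarrow> 'n \<Rightarrow> complex"
  assumes "D \<ge> 0"
    and dual: "\<And>c. (\<Sum>n\<in>I. (cmod (\<Sum>r\<in>P. c r * u r n))\<^sup>2) \<le> D * (\<Sum>r\<in>P. (cmod (c r))\<^sup>2)"
  shows "(\<Sum>r\<in>P. (cmod (\<Sum>n\<in>I. b n * u r n))\<^sup>2) \<le> D * (\<Sum>n\<in>I. (cmod (b n))\<^sup>2)"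
proof -
  define S where "S r = (\<Sum>n\<in>I. b n * u r n)" for r
  define T where "T n = (\<Sum>r\<in>P. cnj (S r) * u r n)" for n
  define X where "X = (\<Sum>r\<in>P. (cmod (S r))\<^sup>2)"
  define B where "B = (\<Sum>n\<in>I. (cmod (b n))\<^sup>2)"
  have X0: "X \<ge> 0" "B \<ge> 0" by (auto simp: X_def B_def intro: sum_nonneg)
  have "complex_of_real X = (\<Sum>r\<in>P. \<Sum>n\<in>I. b n * u r n * cnj (S r))"
    by (simp add: X_def complex_norm_square S_def sum_distrib_right del: of_real_power cnj_sum)
  also have "\<dots> = (\<Sum>n\<in>I. b n * T n)"
    unfolding T_def by (subst sum.swap) (simp add: sum_distrib_left mult_ac)
  finally have "X = cmod (\<Sum>n\<in>I. b n * T n)" using X0 by (metis abs_of_nonneg norm_of_real)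
  also have "\<dots> \<le> (\<Sum>n\<in>I. cmod (b n) * cmod (T n))"
    by (intro order_trans[OF norm_sum] sum_mono) (simp add: norm_mult)
  finally have "X\<^sup>2 \<le> (\<Sum>n\<in>I. cmod (b n) * cmod (T n))\<^sup>2" using X0 by (simp add: power_mono)
  also have "\<dots> \<le> B * (\<Sum>n\<in>I. (cmod (T n))\<^sup>2)" unfolding B_def by (rule Cauchy_Schwarz_ineq_sum)
  also have "\<dots> \<le> B * (D * X)" using dual[of "\<lambda>r. cnj (S r)"] X0
    by (intro mult_left_mono) (auto simp: T_def X_def)
  finally have "X * X \<le> (D * B) * X" by (simp add: power2_eq_square mult_ac)
  \<comment> \<open>Where \<open>X = 0\<close> and cancelling is impossible, \<open>D * B\<close> is
    still nonnegative.\<close>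
  then have "X \<le> D * B" using X0 assms(1)
    by (metis mult_le_cancel_right mult_nonneg_nonneg order_less_le)
  then show ?thesis by (simp add: X_def B_def S_def)
qed

section \<open>The large sieve for spaced points\<close>

text \<open>The subtracted 1/N makes the induction telescope, by 1/(N+1)^2 <= 1/N - 1/(N+1).\<close>

lemma sum_inverse_squares_le: "(\<Sum>k=1..N. 1 / (real k)\<^sup>2) \<le> 2 - 1 / real N"
proof (induction N)
  case (Suc N)
  show ?case
  \<comment> \<open>The telescoping inequality fails at \<open>N = 0\<close>, where 1/0 is 0; the
    sum up to 1 is checked directly.\<close>
  proof (cases "N = 0")
    case False
    then have "1 / (real (Suc N))\<^sup>2 \<le> 1 / real N - 1 / real (Suc N)"
      by (simp add: divide_simps power2_eq_square)
    then show ?thesis using Suc by simp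
  qed simp
qed simp

text \<open>Cells of length \<open>\<delta>\<close> contain at most one point each, so the cell
  index \<open>h\<close> is injective; it is at least 1, and g i >= \<open>\<delta>\<close> h i
  compares the sum with that of 1/k^2.\<close>

lemma sum_inverse_squares_spaced:
  fixes g :: "'i \<Rightarrow> real"
  assumes "finite A" "\<delta> > 0"
    and ge: "\<And>i. i \<in> A \<Longrightarrow> g i \<ge> \<delta>"
    and sp: "\<And>i j. i \<in> A \<Longrightarrow> j \<in> A \<Longrightarrow> i \<noteq> j \<Longrightarrow> \<bar>g i - g j\<bar> \<ge> \<delta>"
  shows "(\<Sum>i\<in>A. 1 / (g i)\<^sup>2) \<le> 2 / \<delta>\<^sup>2"
proof -
  define h where "h i = nat \<lfloor>g i / \<delta>\<rfloor>" for i
  have h1: "h i \<ge> 1" and hle: "real (h i) \<le> g i / \<delta>" and hgt: "g i / \<delta> < real (h i) + 1" if "i \<in> A" for i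
  proof -
    have "g i / \<delta> \<ge> 1" using ge[OF that] assms(2) by simp
    then show "h i \<ge> 1" "real (h i) \<le> g i / \<delta>" "g i / \<delta> < real (h i) + 1"
      unfolding h_def by linarith+
  qed
  have inj: "inj_on h A"
  proof (rule inj_onI, rule ccontr)
    fix i j assume ij: "i \<in> A" "j \<in> A" "h i = h j" "i \<noteq> j"
    have "\<bar>g i / \<delta> - g j / \<delta>\<bar> < 1" using hle[of i] hle[of j] hgt[of i] hgt[of j] ij by auto
    then have "\<bar>g i - g j\<bar> < \<delta>" using assms(2) by (simp add: abs_if field_simps split: if_splits)
    then show False using sp[of i j] ij by auto
  qed
  have "(\<Sum>i\<in>A. 1 / (g i)\<^sup>2) \<le> (\<Sum>i\<in>A. (1 / (real (h i))\<^sup>2) / \<delta>\<^sup>2)"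
  proof (intro sum_mono)
    fix i assume i: "i \<in> A"
    have "(real (h i) * \<delta>)\<^sup>2 \<le> (g i)\<^sup>2" using hle[OF i] assms(2) by (intro power_mono) (auto simp: field_simps)
    moreover have "0 < (real (h i) * \<delta>)\<^sup>2" using h1[OF i] assms(2) by simp
    ultimately have "1 / (g i)\<^sup>2 \<le> 1 / (real (h i) * \<delta>)\<^sup>2" by (intro divide_left_mono mult_pos_pos) auto
    then show "1 / (g i)\<^sup>2 \<le> (1 / (real (h i))\<^sup>2) / \<delta>\<^sup>2" by (simp add: power_mult_distrib)
  qed
  also have "\<dots> = (\<Sum>k\<in>h ` A. 1 / (real k)\<^sup>2) / \<delta>\<^sup>2"
    by (simp add: sum.reindex[OF inj] sum_divide_distrib)
  also have "(\<Sum>k\<in>h ` A. 1 / (real k)\<^sup>2) \<le> (\<Sum>k=1..Max (h ` A). 1 / (real k)\<^sup>2)"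
    using assms(1) h1 by (intro sum_mono2) auto
  also have "\<dots> \<le> 2" using sum_inverse_squares_le[of "Max (h ` A)"]
    by (smt (verit) divide_nonneg_nonneg of_nat_0_le_iff)
  finally show ?thesis using assms(2) by (simp add: divide_right_mono)
qed

text \<open>The closed form bounds the sum by 2/|1 - e(t)|, and |1 - e(t)| is at least the distance
  from t to the nearest integer, the smaller of the two fractional parts. Adding both inverse
  squares avoids the minimum and leaves two one-sided sums to estimate later.\<close>

lemma norm_geometric_unit_exp_le:
  assumes "t \<notin> \<int>"
  shows "(cmod (\<Sum>j<L. unit_exp (real j * t)))\<^sup>2 \<le> 4 * (1 / (frac t)\<^sup>2 + 1 / (frac (- t))\<^sup>2)"
proof -
  define b where "b = frac t"
  define D where "D = (\<Sum>j<L. unit_exp (real j * t))"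
  have b: "0 < b" "b < 1" using assms by (auto simp: b_def frac_lt_1)
  have nb: "frac (- t) = 1 - b" using assms by (simp add: frac_neg b_def)
  have "(1 - unit_exp t) * D = 1 - unit_exp t ^ L"
    by (simp add: D_def unit_exp_of_nat_mult one_diff_power_eq)
  then have "cmod (1 - unit_exp t) * cmod D = cmod (1 - unit_exp t ^ L)" by (metis norm_mult)
  also have "\<dots> \<le> 2" by (rule order_trans[OF norm_triangle_ineq4]) (simp add: norm_power)
  finally have D2: "cmod (1 - unit_exp t) * cmod D \<le> 2" .
  have "min b (1 - b) \<le> cmod (1 - unit_exp t)"
  proof -
    define m where "m = min b (1 - b)"
    have m: "0 < m" "m \<le> 1 / 2" using b by (auto simp: m_def min_def)
    have "sin (pi * b) = sin (pi * m)"
      using sin_pi_minus[of "pi * b"] by (auto simp: m_def min_def algebra_simps)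
    moreover have "pi * m / 2 \<le> sin (pi * m)" using m by (intro half_le_sin) auto
    moreover have "m \<le> pi * m" using m pi_ge_two by simp
    ultimately have "m \<le> 2 * sin (pi * b)" by linarith
    moreover have "cmod (1 - unit_exp t) = 2 * \<bar>sin (pi * b)\<bar>"
      using norm_one_minus_unit_exp[of b] by (simp add: b_def unit_exp_frac)
    ultimately show ?thesis by (simp add: m_def)
  qed
  then have mD: "min b (1 - b) * cmod D \<le> 2" using D2 by (meson mult_right_mono norm_ge_zero order_trans)
  have "(cmod D)\<^sup>2 \<le> 4 / (min b (1 - b))\<^sup>2"
  proof -
    have "(min b (1 - b) * cmod D)\<^sup>2 \<le> 2\<^sup>2" using mD b by (intro power_mono) auto
    then show ?thesis using b by (simp add: power_mult_distrib field_simps)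
  qed
  also have "\<dots> \<le> 4 * (1 / b\<^sup>2 + 1 / (1 - b)\<^sup>2)" using b by (simp add: min_def)
  finally show ?thesis by (simp add: D_def nb flip: b_def)
qed

text \<open>The diagonal term s = r is L^2. Off the diagonal, each of the two one-sided sums of
  inverse squares is at most 2/\<open>\<delta>\<close>^2, and 4 (2 + 2) = 16.\<close>

lemma sum_norm_geometric_spaced_le:
  fixes \<alpha> :: "'r \<Rightarrow> real"
  assumes "finite P" "\<delta> > 0" "r \<in> P"
    and spaced: "\<And>r s. r \<in> P \<Longrightarrow> s \<in> P \<Longrightarrow> r \<noteq> s \<Longrightarrow> frac (\<alpha> r - \<alpha> s) \<ge> \<delta>"
  shows "(\<Sum>s\<in>P. (cmod (\<Sum>j<L. unit_exp (real j * (\<alpha> r - \<alpha> s))))\<^sup>2) \<le> (real L)\<^sup>2 + 16 / \<delta>\<^sup>2"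
proof -
  \<comment> \<open>Subtracting the smaller fractional part from the larger one gives the fractional
    part of the difference, so spacing modulo 1 in both orders becomes ordinary spacing on [0,
    1).\<close>
  have sep: "\<bar>frac (\<alpha> s - c) - frac (\<alpha> s' - c)\<bar> \<ge> \<delta> \<and> \<bar>frac (c - \<alpha> s) - frac (c - \<alpha> s')\<bar> \<ge> \<delta>"
    if "s \<in> P" "s' \<in> P" "s \<noteq> s'" for s s' c
  proof -
    have diff: "frac (u - v) = frac u - frac v" if "frac u \<ge> frac v" for u v :: real
    proof -
      have "u - v - (frac u - frac v) = of_int (\<lfloor>u\<rfloor> - \<lfloor>v\<rfloor>)" by (simp add: frac_def)
      then have "u - v - (frac u - frac v) \<in> \<int>" by (metis Ints_of_int)
      then show ?thesis
        unfolding frac_unique_iff using that frac_lt_1[of u] frac_ge_0[of v] by linarith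
    qed
    have *: "\<bar>frac u - frac v\<bar> \<ge> \<delta>" if "frac (u - v) \<ge> \<delta>" "frac (v - u) \<ge> \<delta>" for u v :: real
      using that diff[of u v] diff[of v u] by linarith
    show ?thesis using spaced[OF that] spaced[of s' s] that by (auto intro!: *)
  qed
  have "(\<Sum>s\<in>P - {r}. (cmod (\<Sum>j<L. unit_exp (real j * (\<alpha> r - \<alpha> s))))\<^sup>2)
      \<le> (\<Sum>s\<in>P - {r}. 4 * (1 / (frac (\<alpha> r - \<alpha> s))\<^sup>2 + 1 / (frac (\<alpha> s - \<alpha> r))\<^sup>2))"
  proof (intro sum_mono)
    fix s assume "s \<in> P - {r}"
    then have "\<delta> \<le> frac (\<alpha> r - \<alpha> s)" using spaced assms(3) by auto
    then have "frac (\<alpha> r - \<alpha> s) > 0" using assms(2) by linarith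
    then show "(cmod (\<Sum>j<L. unit_exp (real j * (\<alpha> r - \<alpha> s))))\<^sup>2
        \<le> 4 * (1 / (frac (\<alpha> r - \<alpha> s))\<^sup>2 + 1 / (frac (\<alpha> s - \<alpha> r))\<^sup>2)"
      using norm_geometric_unit_exp_le[of "\<alpha> r - \<alpha> s" L] by simp
  qed
  also have "\<dots> = 4 * ((\<Sum>s\<in>P - {r}. 1 / (frac (\<alpha> r - \<alpha> s))\<^sup>2) + (\<Sum>s\<in>P - {r}. 1 / (frac (\<alpha> s - \<alpha> r))\<^sup>2))"
    unfolding sum.distrib[symmetric] sum_distrib_left ..
  also have "\<dots> \<le> 4 * (2 / \<delta>\<^sup>2 + 2 / \<delta>\<^sup>2)"
    using assms sep by (intro mult_left_mono add_mono sum_inverse_squares_spaced) auto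
  finally have "(\<Sum>s\<in>P - {r}. (cmod (\<Sum>j<L. unit_exp (real j * (\<alpha> r - \<alpha> s))))\<^sup>2) \<le> 16 / \<delta>\<^sup>2" by simp
  moreover have "cmod (\<Sum>j<L. unit_exp 0) = real L" by (simp add: unit_exp_def)
  ultimately show ?thesis using assms by (simp add: sum.remove[of P r])
qed

text \<open>The map \<open>g\<close> relabels the terms by distinct integers in [0, M]. The
  condition 2M <= L leaves room for the averaging, and 1 <= \<open>\<delta>\<close> L absorbs
  16/\<open>\<delta>\<close>^2 into 16 L^2. The constant is 2 (1 + 16) = 34.\<close>

lemma large_sieve:
  fixes \<alpha> :: "'r \<Rightarrow> real" and g :: "'n \<Rightarrow> nat"
  assumes P: "finite P" "\<delta> > 0"
    and spaced: "\<And>r s. r \<in> P \<Longrightarrow> s \<in> P \<Longrightarrow> r \<noteq> s \<Longrightarrow> frac (\<alpha> r - \<alpha> s) \<ge> \<delta>"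
    and g: "inj_on g I" "\<And>n. n \<in> I \<Longrightarrow> g n \<le> M"
    and L: "2 * M \<le> L" "1 \<le> \<delta> * real L"
  shows "(\<Sum>r\<in>P. (cmod (\<Sum>n\<in>I. b n * unit_exp (real (g n) * \<alpha> r)))\<^sup>2)
    \<le> 34 * real L * (\<Sum>n\<in>I. (cmod (b n))\<^sup>2)"
proof (rule duality_bound)
  fix c :: "'r \<Rightarrow> complex"
  have L0: "L > 0" using L(2) by (cases "L = 0") auto
  define F where "F h = (cmod (\<Sum>r\<in>P. c r * unit_exp (h * \<alpha> r)))\<^sup>2" for h
  define X where "X = (\<Sum>r\<in>P. (cmod (c r))\<^sup>2)"
  have F0: "F h \<ge> 0" for h by (simp add: F_def)
  have X0: "X \<ge> 0" by (auto simp: X_def intro: sum_nonneg)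
  have "(\<Sum>n\<in>I. F (real (g n))) = (\<Sum>m\<in>g ` I. F (real m))"
    by (simp add: sum.reindex[OF g(1)])
  also have "\<dots> \<le> (\<Sum>m\<le>M. F (real m))" using g F0 by (intro sum_mono2) auto
  \<comment> \<open>Each m <= M is the difference (m + j) - j for all j < L - M, which are at least
    L/2 values.\<close>
  finally have "real L / 2 * (\<Sum>n\<in>I. F (real (g n))) \<le> real (L - M) * (\<Sum>m\<le>M. F (real m))"
    using L F0 by (intro mult_mono sum_nonneg) auto
  also have "\<dots> = (\<Sum>m\<le>M. \<Sum>j<L - M. F (real (m + j) - real j))"
    by (simp add: sum_distrib_left)
  also have "\<dots> = (\<Sum>(m, j)\<in>{..M} \<times> {..<L - M}. F (real (m + j) - real j))"
    by (rule sum.cartesian_product)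
  also have "\<dots> = (\<Sum>(i, j)\<in>(\<lambda>(m, j). (m + j, j)) ` ({..M} \<times> {..<L - M}). F (real i - real j))"
    by (subst sum.reindex) (auto simp: inj_on_def intro!: sum.cong)
  \<comment> \<open>By positivity the region may be enlarged to a full square, over which the kernel
    factors as a geometric sum times its conjugate.\<close>
  also have "\<dots> \<le> (\<Sum>(i, j)\<in>{..<L} \<times> {..<L}. F (real i - real j))"
    using L F0 by (intro sum_mono2) auto
  also have "\<dots> = (\<Sum>t\<in>{..<L} \<times> {..<L}. (cmod (\<Sum>r\<in>P. c r * unit_exp ((real (fst t) - real (snd t)) * \<alpha> r)))\<^sup>2)"
    by (simp add: F_def case_prod_beta)
  also have "\<dots> \<le> (\<Sum>r\<in>P. 1 * (cmod (c r))\<^sup>2 * (\<Sum>s\<in>P. cmod (\<Sum>t\<in>{..<L} \<times> {..<L}.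
      unit_exp ((real (fst t) - real (snd t)) * \<alpha> r) * cnj (unit_exp ((real (fst t) - real (snd t)) * \<alpha> s))) / 1))"
    by (rule gram_schur_bound) simp
  also have "\<dots> = (\<Sum>r\<in>P. (cmod (c r))\<^sup>2 * (\<Sum>s\<in>P. (cmod (\<Sum>j<L. unit_exp (real j * (\<alpha> r - \<alpha> s))))\<^sup>2))"
  proof -
    have "(\<Sum>t\<in>{..<L} \<times> {..<L}.
        unit_exp ((real (fst t) - real (snd t)) * \<alpha> r) * cnj (unit_exp ((real (fst t) - real (snd t)) * \<alpha> s)))
      = (\<Sum>j<L. unit_exp (real j * (\<alpha> r - \<alpha> s))) * cnj (\<Sum>j<L. unit_exp (real j * (\<alpha> r - \<alpha> s)))" for r s
      by (simp add: sum_product sum.cartesian_product case_prod_beta cnj_unit_exp algebra_simps flip: unit_exp_add)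
    then show ?thesis by (simp add: norm_mult power2_eq_square del: cnj_sum)
  qed
  also have "\<dots> \<le> (\<Sum>r\<in>P. (cmod (c r))\<^sup>2 * ((real L)\<^sup>2 + 16 / \<delta>\<^sup>2))"
    using assms by (intro sum_mono mult_left_mono sum_norm_geometric_spaced_le) auto
  also have "\<dots> = X * ((real L)\<^sup>2 + 16 / \<delta>\<^sup>2)" by (simp add: X_def sum_distrib_right)
  also have "\<dots> \<le> X * (17 * (real L)\<^sup>2)"
  proof -
    have "1\<^sup>2 \<le> (\<delta> * real L)\<^sup>2" using L(2) by (intro power_mono) auto
    then have "16 / \<delta>\<^sup>2 \<le> 16 * (real L)\<^sup>2" using P(2) by (simp add: field_simps power_mult_distrib)
    then show ?thesis using X0 by (intro mult_left_mono) auto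
  qed
  finally have "real L * (\<Sum>n\<in>I. F (real (g n))) \<le> real L * (34 * real L * X)"
    by (simp add: power2_eq_square algebra_simps)
  then have "(\<Sum>n\<in>I. F (real (g n))) \<le> 34 * real L * X" using L0 by simp
  then show "(\<Sum>n\<in>I. (cmod (\<Sum>r\<in>P. c r * unit_exp (real (g n) * \<alpha> r)))\<^sup>2) \<le> 34 * real L * (\<Sum>r\<in>P. (cmod (c r))\<^sup>2)"
    by (simp add: F_def X_def)
qed simp

section \<open>Detecting congruences modulo q by the sum over c\<close>

text \<open>At most one member of the class lies below q, contributing at most q. For the others q/l
  <= 1/(l div q), and their quotients by q are distinct elements of {1..N}.\<close>

lemma sum_congruence_class_le:
  assumes "q > 0"
  shows "(\<Sum>l\<in>{l \<in> {1..N}. l mod q = k mod q}. real q / real l) \<le> real q + harm N"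
proof -
  define A where "A = {l \<in> {1..N}. l mod q = k mod q}"
  have fin: "finite A" by (simp add: A_def)
  have split: "A = {l \<in> A. l < q} \<union> {l \<in> A. q \<le> l}" by auto
  have "(\<Sum>l\<in>A. real q / real l) = (\<Sum>l\<in>{l \<in> A. l < q}. real q / real l) + (\<Sum>l\<in>{l \<in> A. q \<le> l}. real q / real l)"
    by (subst split, rule sum.union_disjoint) (use fin in auto)
  also have "(\<Sum>l\<in>{l \<in> A. l < q}. real q / real l) \<le> (\<Sum>l\<in>{l \<in> A. l < q}. real q)"
    by (intro sum_mono) (auto simp: A_def field_simps)
  also have "\<dots> \<le> (\<Sum>l\<in>{k mod q}. real q)"
    by (intro sum_mono2) (auto simp: A_def)
  also have "(\<Sum>l\<in>{l \<in> A. q \<le> l}. real q / real l) \<le> (\<Sum>l\<in>{l \<in> A. q \<le> l}. inverse (real (l div q)))"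
  proof (intro sum_mono)
    fix l assume "l \<in> {l \<in> A. q \<le> l}"
    then have l: "l div q > 0" "l > 0" using assms by (auto simp: div_greater_zero_iff)
    have "real q * real (l div q) \<le> real l" by (metis of_nat_le_iff of_nat_mult times_div_less_eq_dividend)
    then show "real q / real l \<le> inverse (real (l div q))" using l by (simp add: field_simps)
  qed
  also have "\<dots> = (\<Sum>j\<in>(\<lambda>l. l div q) ` {l \<in> A. q \<le> l}. inverse (real j))"
  proof -
    have "inj_on (\<lambda>l. l div q) {l \<in> A. q \<le> l}"
      by (rule inj_onI) (metis (mono_tags, lifting) A_def div_mult_mod_eq mem_Collect_eq)
    then show ?thesis by (simp add: sum.reindex)
  qed
  also have "\<dots> \<le> (\<Sum>j=1..N. inverse (real j))"
  proof (intro sum_mono2 subsetI)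
    fix j assume "j \<in> (\<lambda>l. l div q) ` {l \<in> A. q \<le> l}"
    then obtain l where "l \<in> A" "q \<le> l" "j = l div q" by auto
    then show "j \<in> {1..N}"
      using assms div_le_dividend[of l q] div_greater_zero_iff[of l q]
      by (auto simp: A_def intro: order_trans[OF div_le_dividend])
  qed auto
  also have "\<dots> = harm N" by (simp add: harm_def)
  finally show ?thesis by (simp add: A_def)
qed

text \<open>Constant weights would cost the number of elements of a class, of order N/q + 1. The
  weights k replace this by a harmonic sum; the factor k they leave on the right is recovered later
  by the sieve.\<close>

lemma sum_unit_exp_residues_le:
  fixes z :: "nat \<Rightarrow> complex"
  assumes "q > 0" "A \<subseteq> {1..N}"
  shows "(\<Sum>c<q. (cmod (\<Sum>k\<in>A. z k * unit_exp (real c * (real k / real q))))\<^sup>2)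
    \<le> (real q + harm N) * (\<Sum>k\<in>A. real k * (cmod (z k))\<^sup>2)"
proof -
  have finA: "finite A" using assms finite_subset by blast
  define G where "G k l = cmod (\<Sum>c<q. unit_exp (real c * (real k / real q)) * cnj (unit_exp (real c * (real l / real q))))"
    for k l
  \<comment> \<open>A geometric sum whose ratio e((k - l)/q) is a q-th root of unity, equal to 1
    exactly when q divides k - l.\<close>
  have G: "G k l = (if l mod q = k mod q then real q else 0)" for k l
  proof -
    define t where "t = (real k - real l) / real q"
    have Geq: "G k l = cmod (\<Sum>c<q. unit_exp t ^ c)"
      by (simp add: G_def t_def cnj_unit_exp flip: unit_exp_add unit_exp_of_nat_mult)
        (simp add: diff_divide_distrib algebra_simps)
    show ?thesis
    proof (cases "l mod q = k mod q")
      case True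
      then have "int q dvd int k - int l"
        by (metis mod_eq_dvd_iff of_nat_mod)
      then obtain w where w: "int k - int l = int q * w" by blast
      have "real k - real l = real_of_int (int q * w)" unfolding w[symmetric] by simp
      then have "t = of_int w" using assms(1) by (simp add: t_def)
      then show ?thesis using True by (simp add: Geq)
    next
      case False
      have "unit_exp t ^ q = unit_exp (of_int (int k - int l))"
        using assms(1) by (simp add: t_def flip: unit_exp_of_nat_mult)
      then have "unit_exp t ^ q = 1" by (simp only: unit_exp_of_int)
      then have "(1 - unit_exp t) * (\<Sum>c<q. unit_exp t ^ c) = 0"
        by (metis one_diff_power_eq diff_self)
      moreover have "unit_exp t \<noteq> 1"
      proof
        assume "unit_exp t = 1"
        then have "t \<in> \<int>" by (rule unit_exp_eq_1D)
        then obtain w where "t = of_int w" by (rule Ints_cases)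
        then have "real_of_int (int k - int l) = real_of_int (w * int q)"
          using assms(1) by (simp add: t_def field_simps)
        then have "int q dvd int k - int l" by (metis dvd_triv_right of_int_eq_iff)
        then have "int k mod int q = int l mod int q" by (simp add: mod_eq_dvd_iff)
        then show False using False by (metis nat_int zmod_int)
      qed
      ultimately show ?thesis using False by (simp add: Geq)
    qed
  qed
  have "(\<Sum>c<q. (cmod (\<Sum>k\<in>A. z k * unit_exp (real c * (real k / real q))))\<^sup>2)
      \<le> (\<Sum>k\<in>A. real k * (cmod (z k))\<^sup>2 * (\<Sum>l\<in>A. G k l / real l))"
    unfolding G_def by (rule gram_schur_bound) (use assms in auto)
  also have "\<dots> \<le> (\<Sum>k\<in>A. real k * (cmod (z k))\<^sup>2 * (real q + harm N))"
  proof (intro sum_mono mult_left_mono)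
    fix k
    have "(\<Sum>l\<in>A. G k l / real l) = (\<Sum>l\<in>{l \<in> A. l mod q = k mod q}. real q / real l)"
      using finA by (intro sum.mono_neutral_cong_right) (auto simp: G)
    also have "\<dots> \<le> (\<Sum>l\<in>{l \<in> {1..N}. l mod q = k mod q}. real q / real l)"
      using assms by (intro sum_mono2) auto
    also have "\<dots> \<le> real q + harm N" by (rule sum_congruence_class_le[OF assms(1)])
    finally show "(\<Sum>l\<in>A. G k l / real l) \<le> real q + harm N" .
  qed auto
  finally show ?thesis by (simp add: sum_distrib_left mult_ac)
qed

section \<open>Spacing of fractions with prime denominators, and the large sieve along
  progressions\<close>

text \<open>Multiplied by m, the fractional part becomes a nonnegative integer, and it is nonzero
  since m does not divide z.\<close>

lemma frac_fraction_ge: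
  assumes "m > 0" "\<not> int m dvd z"
  shows "1 / real m \<le> frac (of_int z / real m)"
proof -
  define t where "t = of_int z / real m"
  have eq: "frac t * real m = of_int (z - \<lfloor>t\<rfloor> * int m)"
    using assms(1) by (simp add: frac_def t_def field_simps)
  have "z - \<lfloor>t\<rfloor> * int m \<noteq> 0" using assms(2) by (metis dvd_triv_right eq_iff_diff_eq_0)
  moreover have "0 \<le> frac t * real m" by simp
  ultimately have "1 \<le> z - \<lfloor>t\<rfloor> * int m" unfolding eq by linarith
  then have "1 \<le> frac t * real m" unfolding eq by linarith
  then show ?thesis using assms(1) by (simp add: field_simps flip: t_def)
qed

text \<open>The difference is z/(pq) with z = k (cq - dp), so pq must not divide z. If p = q,
  divisibility would force p | c - d with |c - d| < p, hence c = d; otherwise it would force p | cq,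
  impossible for c < p and distinct primes.\<close>

lemma frac_prime_fractions_ge:
  fixes k p q :: nat
  assumes "prime p" "prime q" "real p \<le> Q" "real q \<le> Q" "coprime p k"
    and "c \<in> {1..<p}" "d \<in> {1..<q}" "(p, c) \<noteq> (q, d)"
  shows "1 / Q\<^sup>2 \<le> frac (real k * (real c / real p) - real k * (real d / real q))"
proof -
  have pos: "p > 0" "q > 0" using assms by (auto simp: prime_gt_0_nat)
  define z where "z = int k * (int c * int q - int d * int p)"
  have pP: "prime (int p)" using assms by simp
  have pk: "\<not> int p dvd int k"
    using assms(1,5) by (metis coprime_absorb_left int_dvd_int_iff not_prime_unit)
  have "\<not> int (p * q) dvd z"
  proof
    assume dvd: "int (p * q) dvd z"
    show False
    proof (cases "p = q")
      case True
      have "int p * int p dvd int p * (int k * (int c - int d))"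
        using dvd True by (simp add: z_def algebra_simps)
      then have "int p dvd int k * (int c - int d)" using pos by simp
      then have "int p dvd int c - int d" using pk prime_dvd_mult_iff[OF pP] by blast
      moreover have "\<bar>int c - int d\<bar> < int p" using assms True by auto
      ultimately have "int c - int d = 0" by (metis abs_of_nat dvd_imp_le_int not_le)
      then show False using assms True by auto
    next
      case False
      have "int p dvd z" using dvd by (metis dvd_mult_left of_nat_mult)
      then have "int p dvd int c * int q - int d * int p"
        using pk prime_dvd_mult_iff[OF pP] unfolding z_def by blast
      then have "int p dvd int c * int q" by (metis dvd_diffD dvd_triv_right dvd_diff_commute zdvd_zdiffD)
      then have "p dvd c * q" by (metis int_dvd_int_iff of_nat_mult)
      then have "p dvd c \<or> p dvd q" using assms(1) prime_dvd_mult_iff by blast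
      moreover have "\<not> p dvd c" using assms(6) by (auto dest: dvd_imp_le)
      moreover have "\<not> p dvd q" using assms(1,2) False primes_dvd_imp_eq by blast
      ultimately show False by blast
    qed
  qed
  then have "1 / real (p * q) \<le> frac (of_int z / real (p * q))" using pos by (intro frac_fraction_ge) auto
  also have "of_int z / real (p * q) = real k * (real c / real p) - real k * (real d / real q)"
    using pos by (simp add: z_def field_simps)
  finally have "1 / real (p * q) \<le> frac (real k * (real c / real p) - real k * (real d / real q))" .
  moreover have "1 / Q\<^sup>2 \<le> 1 / real (p * q)"
    using assms(3,4) pos by (auto simp: power2_eq_square intro!: divide_left_mono mult_mono mult_pos_pos)
  ultimately show ?thesis by linarith
qed

text \<open>Writing n = 1 + k g(n) pulls out the unimodular factor e(d/q) and leaves frequencies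
  g(n) <= x/k at the points kd/q, which stay 1/Q^2-spaced because q is coprime to k.\<close>

lemma large_sieve_progression:
  fixes b :: "nat \<Rightarrow> complex" and x Q :: real
  assumes "Q \<ge> 1" "k \<ge> 1"
    and I: "\<And>n. n \<in> I \<Longrightarrow> 1 \<le> n \<and> real n \<le> x \<and> k dvd n - 1"
  shows "(\<Sum>q | prime q \<and> real q \<le> Q \<and> coprime q k. \<Sum>d\<in>{1..<q}.
      (cmod (\<Sum>n\<in>I. b n * unit_exp (real n * (real d / real q))))\<^sup>2)
    \<le> 68 * (x / real k + Q\<^sup>2) * (\<Sum>n\<in>I. (cmod (b n))\<^sup>2)"
proof (cases "I = {}")
  case False
  then have x0: "x \<ge> 0" using I by force
  define R where "R = {q. prime q \<and> real q \<le> Q \<and> coprime q k}"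
  define P where "P = Sigma R (\<lambda>q. {1..<q})"
  define \<alpha> where "\<alpha> r = real k * (real (snd r) / real (fst r))" for r :: "nat \<times> nat"
  define g where "g n = (n - 1) div k" for n
  define M where "M = nat \<lfloor>x / real k\<rfloor>"
  \<comment> \<open>This choice meets both requirements of the sieve. Since Q^2 >= 1, rounding up at
    most doubles Q^2, so L <= 2 (x/k + Q^2), which turns 34 into 68.\<close>
  define L where "L = 2 * M + nat \<lceil>Q\<^sup>2\<rceil>"
  have finR: "finite R"
    by (rule finite_subset[of _ "{..nat \<lfloor>Q\<rfloor>}"]) (auto simp: R_def le_nat_floor)
  have ng: "n = 1 + k * g n" if "n \<in> I" for n using I[OF that] by (simp add: g_def)
  have M: "real M \<le> x / real k" using x0 by (simp add: M_def)
  have "1 \<le> Q\<^sup>2" using assms(1) by simp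
  then have L: "real L \<le> 2 * (x / real k + Q\<^sup>2)" "Q\<^sup>2 \<le> real L" using M by (simp_all add: L_def) linarith+
  have "(\<Sum>r\<in>P. (cmod (\<Sum>n\<in>I. b n * unit_exp (real (g n) * \<alpha> r)))\<^sup>2)
      \<le> 34 * real L * (\<Sum>n\<in>I. (cmod (b n))\<^sup>2)"
  proof (rule large_sieve[where \<delta> = "1 / Q\<^sup>2" and M = M])
    show "inj_on g I" by (rule inj_onI) (metis ng)
    show "g n \<le> M" if "n \<in> I" for n
    proof -
      have "real (k * g n) \<le> x" using ng[OF that] I[OF that] by linarith
      then show ?thesis using assms(2) unfolding M_def by (intro le_nat_floor) (simp add: field_simps)
    qed
    show "1 \<le> 1 / Q\<^sup>2 * real L" using L(2) assms(1) by (simp add: field_simps)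
    show "frac (\<alpha> r - \<alpha> s) \<ge> 1 / Q\<^sup>2" if "r \<in> P" "s \<in> P" "r \<noteq> s" for r s
      using that unfolding \<alpha>_def by (intro frac_prime_fractions_ge) (auto simp: P_def R_def)
  qed (use assms finR in \<open>auto simp: P_def L_def\<close>)
  also have "\<dots> \<le> 68 * (x / real k + Q\<^sup>2) * (\<Sum>n\<in>I. (cmod (b n))\<^sup>2)"
    using L(1) by (intro mult_right_mono sum_nonneg) auto
  also have "(\<Sum>r\<in>P. (cmod (\<Sum>n\<in>I. b n * unit_exp (real (g n) * \<alpha> r)))\<^sup>2)
     = (\<Sum>r\<in>P. (cmod (\<Sum>n\<in>I. b n * unit_exp (real n * (real (snd r) / real (fst r)))))\<^sup>2)"
  proof (intro sum.cong refl)
    fix r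
    define t where "t = real (snd r) / real (fst r)"
    have "(\<Sum>n\<in>I. b n * unit_exp (real n * t)) = (\<Sum>n\<in>I. unit_exp t * (b n * unit_exp (real (g n) * \<alpha> r)))"
    proof (intro sum.cong refl)
      fix n assume "n \<in> I"
      then have "real n = 1 + real k * real (g n)" by (metis ng of_nat_1 of_nat_add of_nat_mult)
      then have "real n * t = t + real (g n) * \<alpha> r" by (simp add: \<alpha>_def t_def algebra_simps)
      then show "b n * unit_exp (real n * t) = unit_exp t * (b n * unit_exp (real (g n) * \<alpha> r))"
        by (simp add: unit_exp_add)
    qed
    then show "(cmod (\<Sum>n\<in>I. b n * unit_exp (real (g n) * \<alpha> r)))\<^sup>2
        = (cmod (\<Sum>n\<in>I. b n * unit_exp (real n * (real (snd r) / real (fst r)))))\<^sup>2"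
      by (simp add: norm_mult flip: t_def sum_distrib_left)
  qed
  also have "\<dots> = (\<Sum>q\<in>R. \<Sum>d\<in>{1..<q}. (cmod (\<Sum>n\<in>I. b n * unit_exp (real n * (real d / real q))))\<^sup>2)"
    unfolding P_def using finR by (subst sum.Sigma) (auto simp: case_prod_beta)
  finally show ?thesis by (simp add: R_def)
qed simp

section \<open>Assembling the bound over the fibres of f\<close>

theorem theorem4:
  fixes C \<theta> \<kappa> :: real
  assumes "C > 0" and "0 < \<theta>" and "\<theta> < 1" and "\<kappa> > 0"
  shows "\<exists>K::real. K > 0 \<and>
    (\<forall>(x::real) (Q::real) (f::nat \<Rightarrow> int) (a::nat \<Rightarrow> complex).
      x \<ge> 2 \<longrightarrow> Q \<ge> 2 \<longrightarrow> Q \<ge> \<kappa> * ln x \<longrightarrow>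
      (\<forall>n::nat. 1 \<le> n \<longrightarrow> real n \<le> x \<longrightarrow>
         1 \<le> f n \<and> real_of_int (f n) \<le> C * x powr \<theta> \<and> f n dvd (int n - 1)) \<longrightarrow>
      (\<Sum>q | prime (q::nat) \<and> odd q \<and> real q \<le> Q.
         \<Sum>c\<in>{1..<q}. \<Sum>d\<in>{1..<q}.
           (cmod (\<Sum>n | 1 \<le> n \<and> real n \<le> x \<and> gcd (int q) (f n) = 1.
              a n * unit_exp (real_of_int (int n * int d + f n * int c) / real q)))\<^sup>2)
      \<le> K * (Q * x + Q ^ 3 * x powr \<theta> * ln Q) *
          (\<Sum>n | 1 \<le> n \<and> real n \<le> x. (cmod (a n))\<^sup>2))"
proof -
  \<comment> \<open>\<open>K1\<close> is chosen so that Q + H_N <= K1 Q. In \<open>K\<close>, 68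
    comes from the sieve, and C / ln 2 from replacing C by a multiple of ln Q >= ln 2.\<close>
  define K1 where "K1 = 2 + \<bar>ln C\<bar> + 1 / \<kappa>"
  define K where "K = 68 * K1 * (1 + C / ln 2)"
  have K1: "K1 > 0" using assms by (simp add: K1_def add_pos_pos add_nonneg_pos)
  have "K > 0" using K1 assms by (simp add: K_def add_pos_pos)
  moreover have "(\<Sum>q | prime (q::nat) \<and> odd q \<and> real q \<le> Q.
         \<Sum>c\<in>{1..<q}. \<Sum>d\<in>{1..<q}.
           (cmod (\<Sum>n | 1 \<le> n \<and> real n \<le> x \<and> gcd (int q) (f n) = 1.
              a n * unit_exp (real_of_int (int n * int d + f n * int c) / real q)))\<^sup>2)
      \<le> K * (Q * x + Q ^ 3 * x powr \<theta> * ln Q) *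
          (\<Sum>n | 1 \<le> n \<and> real n \<le> x. (cmod (a n))\<^sup>2)"
    if x: "x \<ge> 2" and Q: "Q \<ge> 2" and Qx: "Q \<ge> \<kappa> * ln x"
      and f: "\<And>n::nat. 1 \<le> n \<Longrightarrow> real n \<le> x \<Longrightarrow>
         1 \<le> f n \<and> real_of_int (f n) \<le> C * x powr \<theta> \<and> f n dvd (int n - 1)"
    for x Q :: real and f :: "nat \<Rightarrow> int" and a :: "nat \<Rightarrow> complex"
  proof -
    define y where "y = C * x powr \<theta>"
    define N where "N = nat \<lfloor>y\<rfloor>"
    define J where "J = {n::nat. 1 \<le> n \<and> real n \<le> x}"
    define F where "F n = nat (f n)" for n
    define Jk where "Jk k = {n \<in> J. F n = k}" for k
    define W where "W = Q + harm N"
    define R where "R = {q::nat. prime q \<and> odd q \<and> real q \<le> Q}"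
    define A where "A q = {k \<in> {1..N}. coprime q k}" for q
    define S where "S k q d = (\<Sum>n\<in>Jk k. a n * unit_exp (real n * (real d / real q)))" for k q d :: nat
    define B where "B = (\<Sum>n\<in>J. (cmod (a n))\<^sup>2)"
    have y0: "y \<ge> 0" using assms by (simp add: y_def)
    have B0: "B \<ge> 0" by (auto simp: B_def intro: sum_nonneg)
    have finJ: "finite J" by (rule finite_subset[of _ "{..nat \<lfloor>x\<rfloor>}"]) (auto simp: J_def le_nat_floor)
    have finR: "finite R" by (rule finite_subset[of _ "{..nat \<lfloor>Q\<rfloor>}"]) (auto simp: R_def le_nat_floor)
    have F: "int (F n) = f n" "F n \<in> {1..N}" "F n dvd n - 1" if "n \<in> J" for n
    proof -
      have fn: "1 \<le> f n" "real_of_int (f n) \<le> y" "f n dvd int n - 1" "1 \<le> n"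
        using that f[of n] by (auto simp: J_def y_def)
      show F1: "int (F n) = f n" using fn by (simp add: F_def)
      have "real (F n) \<le> y" using fn(2) F1 by (metis of_int_of_nat_eq)
      then show "F n \<in> {1..N}" using fn by (auto simp: N_def F_def le_nat_floor)
      have "int (F n) dvd int (n - 1)" using fn F1 by (simp add: of_nat_diff)
      then show "F n dvd n - 1" by (simp only: int_dvd_int_iff)
    qed
    have W: "W \<le> K1 * Q"
    proof -
      have "harm N \<le> 1 + \<bar>ln C\<bar> + Q / \<kappa>"
      proof (cases "N = 0")
        case True
        then show ?thesis using Q assms by (simp add: harm_def)
      next
        case False
        \<comment> \<open>The sequence H_n - ln n is decreasing and equals 1 at n = 1.\<close>
        have "harm N \<le> 1 + ln (real N)" using euler_mascheroni_sequence_decreasing[of 1 N] False by (simp add: harm_def)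
        also have "ln (real N) \<le> ln y" using False y0 by (intro ln_mono) (auto simp: N_def)
        also have "ln y = ln C + \<theta> * ln x" using assms x by (simp add: y_def ln_mult ln_powr)
        also have "\<theta> * ln x \<le> 1 * ln x" using assms x by (intro mult_right_mono) auto
        also have "ln x \<le> Q / \<kappa>" using Qx assms by (simp add: field_simps)
        finally show ?thesis by simp
      qed
      moreover have "1 + \<bar>ln C\<bar> \<le> (1 + \<bar>ln C\<bar>) * Q" using Q mult_left_mono[of 1 Q "1 + \<bar>ln C\<bar>"] by simp
      ultimately show ?thesis by (simp add: W_def K1_def algebra_simps)
    qed
    have fixed: "(\<Sum>c\<in>{1..<q}. (cmod (\<Sum>n | 1 \<le> n \<and> real n \<le> x \<and> gcd (int q) (f n) = 1.
              a n * unit_exp (real_of_int (int n * int d + f n * int c) / real q)))\<^sup>2)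
        \<le> W * (\<Sum>k\<in>A q. real k * (cmod (S k q d))\<^sup>2)" if q: "q \<in> R" for q d
    proof -
      have q0: "q > 0" "real q \<le> Q" using q by (auto simp: R_def prime_gt_0_nat)
      \<comment> \<open>Both the gcd condition and the factor e(f(n)c/q) depend only on k = f(n), so
        they are constant on each fibre.\<close>
      have inner: "(\<Sum>n | 1 \<le> n \<and> real n \<le> x \<and> gcd (int q) (f n) = 1.
              a n * unit_exp (real_of_int (int n * int d + f n * int c) / real q))
          = (\<Sum>k\<in>A q. S k q d * unit_exp (real c * (real k / real q)))" for c :: nat
      proof -
        define h where "h n = a n * unit_exp (real n * (real d / real q)) * unit_exp (real c * (real (F n) / real q))" for n
        have eq: "{n. 1 \<le> n \<and> real n \<le> x \<and> gcd (int q) (f n) = 1} = {n \<in> J. F n \<in> A q}"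
        proof -
          have iff: "gcd (int q) (f n) = 1 \<longleftrightarrow> F n \<in> A q" if "n \<in> J" for n
          proof -
            have "gcd (int q) (f n) = int (gcd q (F n))" by (simp flip: F(1)[OF that])
            then show ?thesis using F(2)[OF that] by (simp add: A_def coprime_iff_gcd_eq_1)
          qed
          have "{n. 1 \<le> n \<and> real n \<le> x \<and> gcd (int q) (f n) = 1} = {n \<in> J. gcd (int q) (f n) = 1}"
            by (simp only: J_def mem_Collect_eq conj_assoc)
          also have "\<dots> = {n \<in> J. F n \<in> A q}"
            by (intro Collect_cong conj_cong refl iff)
          finally show ?thesis .
        qed
        have "(\<Sum>n\<in>{n \<in> J. F n \<in> A q}. a n * unit_exp (real_of_int (int n * int d + f n * int c) / real q))
            = (\<Sum>n\<in>{n \<in> J. F n \<in> A q}. h n)"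
        proof (intro sum.cong refl)
          fix n assume "n \<in> {n \<in> J. F n \<in> A q}"
          then have "f n = int (F n)" using F by auto
          then have "real_of_int (int n * int d + f n * int c) / real q
              = real n * (real d / real q) + real c * (real (F n) / real q)"
            by (simp add: add_divide_distrib mult.commute)
          then show "a n * unit_exp (real_of_int (int n * int d + f n * int c) / real q) = h n"
            by (simp add: h_def unit_exp_add mult.assoc)
        qed
        also have "\<dots> = (\<Sum>k\<in>A q. \<Sum>n\<in>{n \<in> {n \<in> J. F n \<in> A q}. F n = k}. h n)"
          by (rule sum.group[symmetric]) (use finJ in \<open>auto simp: A_def\<close>)
        also have "\<dots> = (\<Sum>k\<in>A q. S k q d * unit_exp (real c * (real k / real q)))"
          unfolding S_def sum_distrib_right by (intro sum.cong) (auto simp: Jk_def h_def)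
        finally show ?thesis unfolding eq .
      qed
      \<comment> \<open>Adding the nonnegative term c = 0 completes the residue system, as
        orthogonality requires.\<close>
      have "(\<Sum>c\<in>{1..<q}. (cmod (\<Sum>k\<in>A q. S k q d * unit_exp (real c * (real k / real q))))\<^sup>2)
          \<le> (\<Sum>c<q. (cmod (\<Sum>k\<in>A q. S k q d * unit_exp (real c * (real k / real q))))\<^sup>2)"
        by (intro sum_mono2) auto
      also have "\<dots> \<le> (real q + harm N) * (\<Sum>k\<in>A q. real k * (cmod (S k q d))\<^sup>2)"
        by (rule sum_unit_exp_residues_le) (use q0 in \<open>auto simp: A_def\<close>)
      also have "\<dots> \<le> W * (\<Sum>k\<in>A q. real k * (cmod (S k q d))\<^sup>2)"
        using q0 by (intro mult_right_mono sum_nonneg) (auto simp: W_def)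
      finally show ?thesis by (simp only: inner)
    qed
    have "(\<Sum>q\<in>R. \<Sum>c\<in>{1..<q}. \<Sum>d\<in>{1..<q}.
           (cmod (\<Sum>n | 1 \<le> n \<and> real n \<le> x \<and> gcd (int q) (f n) = 1.
              a n * unit_exp (real_of_int (int n * int d + f n * int c) / real q)))\<^sup>2)
        \<le> (\<Sum>q\<in>R. \<Sum>d\<in>{1..<q}. W * (\<Sum>k\<in>A q. real k * (cmod (S k q d))\<^sup>2))"
      by (rule sum_mono, rule ord_eq_le_trans[OF sum.swap], rule sum_mono, rule fixed)
    also have "\<dots> = (\<Sum>q\<in>R. \<Sum>k\<in>A q. W * (real k * (\<Sum>d\<in>{1..<q}. (cmod (S k q d))\<^sup>2)))"
      unfolding sum_distrib_left by (rule sum.cong[OF refl], rule sum.swap)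
    \<comment> \<open>With k outermost, coprimality becomes a restriction on q, and the sieve
      applies to each fibre separately.\<close>
    also have "\<dots> = (\<Sum>k=1..N. \<Sum>q\<in>{q \<in> R. coprime q k}. W * (real k * (\<Sum>d\<in>{1..<q}. (cmod (S k q d))\<^sup>2)))"
      unfolding A_def using finR by (intro sum.swap_restrict) auto
    also have "\<dots> \<le> (\<Sum>k=1..N. K1 * Q * (68 * (x + y * Q\<^sup>2) * (\<Sum>n\<in>Jk k. (cmod (a n))\<^sup>2)))"
    proof (intro sum_mono)
      fix k assume "k \<in> {1..N}"
      moreover have "real N \<le> y" unfolding N_def using y0 by (rule of_nat_floor)
      ultimately have k: "1 \<le> k" "real k \<le> y" by auto
      have "(\<Sum>q\<in>{q \<in> R. coprime q k}. \<Sum>d\<in>{1..<q}. (cmod (S k q d))\<^sup>2)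
          \<le> (\<Sum>q | prime q \<and> real q \<le> Q \<and> coprime q k. \<Sum>d\<in>{1..<q}. (cmod (S k q d))\<^sup>2)"
      proof (rule sum_mono2)
        show "finite {q. prime q \<and> real q \<le> Q \<and> coprime q k}"
          by (rule finite_subset[of _ "{..nat \<lfloor>Q\<rfloor>}"]) (auto simp: le_nat_floor)
      qed (auto simp: R_def intro: sum_nonneg)
      also have "\<dots> \<le> 68 * (x / real k + Q\<^sup>2) * (\<Sum>n\<in>Jk k. (cmod (a n))\<^sup>2)"
        unfolding S_def using Q k F(3)
        by (intro large_sieve_progression) (auto simp: Jk_def J_def)
      finally have "real k * (\<Sum>q\<in>{q \<in> R. coprime q k}. \<Sum>d\<in>{1..<q}. (cmod (S k q d))\<^sup>2)
          \<le> real k * (68 * (x / real k + Q\<^sup>2) * (\<Sum>n\<in>Jk k. (cmod (a n))\<^sup>2))"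
        by (rule mult_left_mono) simp
      \<comment> \<open>Here the weight k cancels against the saving in x/k.\<close>
      also have "\<dots> = 68 * (x + real k * Q\<^sup>2) * (\<Sum>n\<in>Jk k. (cmod (a n))\<^sup>2)"
        using k by (simp add: field_simps)
      also have "\<dots> \<le> 68 * (x + y * Q\<^sup>2) * (\<Sum>n\<in>Jk k. (cmod (a n))\<^sup>2)"
        using k by (intro mult_right_mono mult_left_mono add_left_mono sum_nonneg) auto
      finally have le: "real k * (\<Sum>q\<in>{q \<in> R. coprime q k}. \<Sum>d\<in>{1..<q}. (cmod (S k q d))\<^sup>2)
          \<le> 68 * (x + y * Q\<^sup>2) * (\<Sum>n\<in>Jk k. (cmod (a n))\<^sup>2)" .
      have "W * (real k * (\<Sum>q\<in>{q \<in> R. coprime q k}. \<Sum>d\<in>{1..<q}. (cmod (S k q d))\<^sup>2))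
          \<le> K1 * Q * (68 * (x + y * Q\<^sup>2) * (\<Sum>n\<in>Jk k. (cmod (a n))\<^sup>2))"
        by (rule mult_mono[OF W le]) (use K1 Q in \<open>auto intro!: mult_nonneg_nonneg sum_nonneg\<close>)
      then show "(\<Sum>q\<in>{q \<in> R. coprime q k}. W * (real k * (\<Sum>d\<in>{1..<q}. (cmod (S k q d))\<^sup>2)))
          \<le> K1 * Q * (68 * (x + y * Q\<^sup>2) * (\<Sum>n\<in>Jk k. (cmod (a n))\<^sup>2))"
        by (simp only: sum_distrib_left)
    qed
    also have "\<dots> = K1 * Q * (68 * (x + y * Q\<^sup>2) * (\<Sum>k=1..N. \<Sum>n\<in>Jk k. (cmod (a n))\<^sup>2))"
      by (simp only: sum_distrib_left)
    \<comment> \<open>The fibres partition \<open>J\<close>, because every value \<open>F n\<close>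
      lies in {1..N}.\<close>
    also have "(\<Sum>k=1..N. \<Sum>n\<in>Jk k. (cmod (a n))\<^sup>2) = B"
      unfolding B_def Jk_def using F(2) finJ by (intro sum.group) auto
    also have "K1 * Q * (68 * (x + y * Q\<^sup>2) * B) \<le> K * (Q * x + Q ^ 3 * x powr \<theta> * ln Q) * B"
    proof -
      have "1 \<le> ln Q / ln 2" using Q by simp
      then have "Q ^ 3 * y * 1 \<le> Q ^ 3 * y * (ln Q / ln 2)"
        using y0 Q by (intro mult_left_mono) auto
      also have "\<dots> = C / ln 2 * (Q ^ 3 * x powr \<theta> * ln Q)" by (simp add: y_def)
      finally have "Q * x + Q ^ 3 * y \<le> Q * x + C / ln 2 * (Q ^ 3 * x powr \<theta> * ln Q)" by simp
      also have "\<dots> \<le> (1 + C / ln 2) * (Q * x + Q ^ 3 * x powr \<theta> * ln Q)"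
      proof -
        have "0 \<le> C / ln 2 * (Q * x)" "0 \<le> Q ^ 3 * x powr \<theta> * ln Q" using assms Q x by auto
        then show ?thesis by (simp add: algebra_simps)
      qed
      finally have "68 * K1 * (Q * x + Q ^ 3 * y) * B
          \<le> 68 * K1 * ((1 + C / ln 2) * (Q * x + Q ^ 3 * x powr \<theta> * ln Q)) * B"
        using K1 B0 by (intro mult_right_mono mult_left_mono) auto
      moreover have "K1 * Q * (68 * (x + y * Q\<^sup>2) * B) = 68 * K1 * (Q * x + Q ^ 3 * y) * B"
        by (simp add: algebra_simps power2_eq_square power3_eq_cube)
      ultimately show ?thesis by (simp only: K_def mult.assoc)
    qed
    finally show ?thesis by (simp only: R_def B_def J_def)
  qed
  ultimately show ?thesis by blast
qed

end
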